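(* Let $(V,J,g)$ be a pseudo-Hermitian vector space with $\omega=g(J\cdot,\cdot)$. Then $$C_J(\mathfrak{sp}(V))=\bigcup_US^{3,0}U^\rho\subset S^3V,$$ where the union is over all isotropic complex subspaces $U\subset V$ of maximal dimension.
   Context: $(V,J,g)$ is a finite-dimensional real vector space with complex structure $J$ and a possibly indefinite $J$-invariant scalar product $g$; $\omega=g(J\cdot,\cdot)$ is a symplectic form. The first prolongation $\mathfrak{sp}(V)^{(1)}$, i.e. the space of linear maps $S:V\to\mathfrak{sp}(V)$ with $S_XY=S_YX$, is identified with $S^3V^*$ via the trilinear form $\omega(S_XY,Z)$, and with $S^3V$ via $V\cong V^*$, $v\mapsto\omega(v,\cdot)$. $C(\mathfrak{sp}(V))=\{S\in\mathfrak{sp}(V)^{(1)}\mid[S_X,S_Y]=0\ \forall X,Y\in V\}$ and $$C_J(\mathfrak{sp}(V))=\{S\in C(\mathfrak{sp}(V))\mid S_XJ+JS_X=0\ \forall X\in V\}.$$ A complex subspace is a $J$-invariant real subspace; isotropic means $\omega$-isotropic (equivalently, for complex subspaces, $g$-isotropic). $V^{\mathbb C}=V\otimes\mathbb C=V^{1,0}\oplus V^{0,1}$ is the decomposition into $\pm i$-eigenspaces of $J$. For a $J$-invariant subspace $U$, $U^{1,0}=(U\otimes\mathbb C)\cap V^{1,0}$, $S^{3,0}U=S^3U^{1,0}$, and $$S^{3,0}U^\rho=\{S_c+\overline{S}_c\mid S_c\in S^{3,0}U\}\subset S^3U,$$ where the bar is complex conjugation on $S^3V^{\mathbb C}$. 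*)

theory Defs
  imports "HOL-Analysis.Analysis"
begin

locale pseudo_hermitian =
  fixes J :: "'v::real_vector \<Rightarrow> 'v" and g :: "'v \<Rightarrow> 'v \<Rightarrow> real"
  assumes finite_dim: "\<exists>B::'v set. finite B \<and> span B = UNIV"
    and J_linear: "linear J"
    and J_square: "J (J x) = - x"
    and g_bilinear: "bilinear g"
    and g_sym: "g x y = g y x"
    and g_nondegenerate: "(\<And>y. g x y = 0) \<Longrightarrow> x = 0"
    and g_invariant: "g (J x) (J y) = g x y"

definition omega :: "('v::real_vector \<Rightarrow> 'v) \<Rightarrow> ('v \<Rightarrow> 'v \<Rightarrow> real) \<Rightarrow> 'v \<Rightarrow> 'v \<Rightarrow> real" where
  "omega J g X Y = g (J X) Y"

definition sp :: "('v::real_vector \<Rightarrow> 'v \<Rightarrow> real) \<Rightarrow> ('v \<Rightarrow> 'v) set" where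
  "sp \<omega> = {A. linear A \<and> (\<forall>X Y. \<omega> (A X) Y + \<omega> X (A Y) = 0)}"

definition sp_prolongation :: "('v::real_vector \<Rightarrow> 'v \<Rightarrow> real) \<Rightarrow> ('v \<Rightarrow> 'v \<Rightarrow> 'v) set" where
  "sp_prolongation \<omega> =
    {S. (\<forall>X. S X \<in> sp \<omega>) \<and> (\<forall>Y. linear (\<lambda>X. S X Y)) \<and> (\<forall>X Y. S X Y = S Y X)}"

definition C_sp :: "('v::real_vector \<Rightarrow> 'v \<Rightarrow> real) \<Rightarrow> ('v \<Rightarrow> 'v \<Rightarrow> 'v) set" where
  "C_sp \<omega> = {S \<in> sp_prolongation \<omega>. \<forall>X Y Z. S X (S Y Z) - S Y (S X Z) = 0}"

definition CJ_sp ::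
  "('v::real_vector \<Rightarrow> 'v) \<Rightarrow> ('v \<Rightarrow> 'v \<Rightarrow> real) \<Rightarrow> ('v \<Rightarrow> 'v \<Rightarrow> 'v) set" where
  "CJ_sp J \<omega> = {S \<in> C_sp \<omega>. \<forall>X Y. S X (J Y) + J (S X Y) = 0}"


text \<open>The algebraic dual. The library type of bounded linear maps would require a norm on \<open>V\<close>.\<close>

typedef (overloaded) ('v::real_vector) dual = "{f :: 'v \<Rightarrow> real. linear f}"
  morphisms dual_apply Dual
  by (auto intro: exI[of _ "\<lambda>_. 0"] simp: linear_zero)

setup_lifting type_definition_dual

instantiation dual :: (real_vector) real_vector
begin

lift_definition zero_dual :: "'a dual" is "\<lambda>_. 0"
  by (simp add: linear_zero)

lift_definition plus_dual :: "'a dual \<Rightarrow> 'a dual \<Rightarrow> 'a dual" is "\<lambda>f g x. f x + g x"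
  by (simp add: linear_compose_add)

lift_definition minus_dual :: "'a dual \<Rightarrow> 'a dual \<Rightarrow> 'a dual" is "\<lambda>f g x. f x - g x"
  by (simp add: linear_compose_sub)

lift_definition uminus_dual :: "'a dual \<Rightarrow> 'a dual" is "\<lambda>f x. - f x"
  by (simp add: linear_compose_neg)

lift_definition scaleR_dual :: "real \<Rightarrow> 'a dual \<Rightarrow> 'a dual" is "\<lambda>c f x. c *\<^sub>R f x"
  by (rule linear_compose_scale_right)

instance
  by standard (transfer; simp add: fun_eq_iff algebra_simps)+

end


text \<open>Symmetric trilinear forms on a real vector space \<open>W\<close>, i.e. \<open>S\<^sup>3W\<^sup>*\<close>. Since the spaces in question
  are finite-dimensional, \<open>S\<^sup>3V\<close> is \<open>S\<^sup>3(V\<^sup>*)\<^sup>*\<close>, the symmetric trilinear forms on \<open>V\<^sup>*\<close>; the tensor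
  \<open>u \<otimes> v \<otimes> w\<close> is the form \<open>(\<alpha>, \<beta>, \<gamma>) \<mapsto> \<alpha>(u) \<beta>(v) \<gamma>(w)\<close>.\<close>

definition sym_forms3 :: "('w::real_vector \<Rightarrow> 'w \<Rightarrow> 'w \<Rightarrow> real) set" where
  "sym_forms3 =
    {T. (\<forall>b c. linear (\<lambda>a. T a b c)) \<and> (\<forall>a c. linear (\<lambda>b. T a b c)) \<and> (\<forall>a b. linear (T a b))
      \<and> (\<forall>a b c. T a b c = T b a c \<and> T a b c = T a c b)}"

type_synonym 'v tensor3 = "'v dual \<Rightarrow> 'v dual \<Rightarrow> 'v dual \<Rightarrow> real"
type_synonym 'v ctensor3 = "'v dual \<Rightarrow> 'v dual \<Rightarrow> 'v dual \<Rightarrow> complex"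

abbreviation S3 :: "'v::real_vector tensor3 set" where
  "S3 \<equiv> sym_forms3"

definition form_of_prolongation ::
  "('v::real_vector \<Rightarrow> 'v \<Rightarrow> real) \<Rightarrow> ('v \<Rightarrow> 'v \<Rightarrow> 'v) \<Rightarrow> ('v \<Rightarrow> 'v \<Rightarrow> 'v \<Rightarrow> real)" where
  "form_of_prolongation \<omega> S = (\<lambda>X Y Z. \<omega> (S X Y) Z)"

text \<open>The isomorphism \<open>S\<^sup>3V \<rightarrow> S\<^sup>3V\<^sup>*\<close> induced by \<open>v \<mapsto> \<omega>(v, \<cdot>)\<close>. It sends \<open>u \<otimes> v \<otimes> w\<close> to
  \<open>(X, Y, Z) \<mapsto> \<omega>(u, X) \<omega>(v, Y) \<omega>(w, Z)\<close>; hence a tensor is evaluated on the covectors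
  \<open>\<omega>(\<cdot>, X)\<close>, with the vector in the second argument.\<close>

definition form_of_tensor ::
  "('v::real_vector \<Rightarrow> 'v \<Rightarrow> real) \<Rightarrow> 'v tensor3 \<Rightarrow> ('v \<Rightarrow> 'v \<Rightarrow> 'v \<Rightarrow> real)" where
  "form_of_tensor \<omega> T =
    (\<lambda>X Y Z. T (Dual (\<lambda>u. \<omega> u X)) (Dual (\<lambda>u. \<omega> u Y)) (Dual (\<lambda>u. \<omega> u Z)))"

text \<open>For nondegenerate \<open>\<omega>\<close> and finite-dimensional \<open>V\<close>, \<open>form_of_tensor \<omega>\<close> is a bijection
  from \<open>S\<^sup>3V\<close> to \<open>S\<^sup>3V\<^sup>*\<close> and \<open>form_of_prolongation \<omega>\<close> one from the first prolongation to
  \<open>S\<^sup>3V\<^sup>*\<close>.\<close>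

definition tensor_of_prolongation ::
  "('v::real_vector \<Rightarrow> 'v \<Rightarrow> real) \<Rightarrow> ('v \<Rightarrow> 'v \<Rightarrow> 'v) \<Rightarrow> 'v tensor3" where
  "tensor_of_prolongation \<omega> S =
    inv_into S3 (form_of_tensor \<omega>) (form_of_prolongation \<omega> S)"


text \<open>The complexification \<open>V \<otimes> \<complex>\<close> is \<open>V \<times> V\<close>, the pair \<open>(x, y)\<close> standing for \<open>x + \<i>y\<close>.
  A real covector extends complex linearly to it.\<close>

type_synonym 'v cplxn = "'v \<times> 'v"

definition cplxn_scale :: "complex \<Rightarrow> 'v::real_vector cplxn \<Rightarrow> 'v cplxn" where
  "cplxn_scale c z =
    (Re c *\<^sub>R fst z - Im c *\<^sub>R snd z, Im c *\<^sub>R fst z + Re c *\<^sub>R snd z)"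

definition cplxn_map :: "('v \<Rightarrow> 'v) \<Rightarrow> 'v cplxn \<Rightarrow> 'v cplxn" where
  "cplxn_map A z = (A (fst z), A (snd z))"

definition cplxn_eval :: "'v::real_vector dual \<Rightarrow> 'v cplxn \<Rightarrow> complex" where
  "cplxn_eval \<alpha> z = Complex (dual_apply \<alpha> (fst z)) (dual_apply \<alpha> (snd z))"

definition V10 :: "('v::real_vector \<Rightarrow> 'v) \<Rightarrow> 'v cplxn set" where
  "V10 J = {z. cplxn_map J z = cplxn_scale \<i> z}"

definition U10 :: "('v::real_vector \<Rightarrow> 'v) \<Rightarrow> 'v set \<Rightarrow> 'v cplxn set" where
  "U10 J U = (U \<times> U) \<inter> V10 J"

definition ctensor :: "'v::real_vector cplxn \<Rightarrow> 'v cplxn \<Rightarrow> 'v cplxn \<Rightarrow> 'v ctensor3" where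
  "ctensor u v w = (\<lambda>\<alpha> \<beta> \<gamma>. cplxn_eval \<alpha> u * cplxn_eval \<beta> v * cplxn_eval \<gamma> w)"

definition sym_prod :: "'v::real_vector cplxn \<Rightarrow> 'v cplxn \<Rightarrow> 'v cplxn \<Rightarrow> 'v ctensor3" where
  "sym_prod u v w = (\<lambda>\<alpha> \<beta> \<gamma>.
    (ctensor u v w \<alpha> \<beta> \<gamma> + ctensor u w v \<alpha> \<beta> \<gamma> + ctensor v u w \<alpha> \<beta> \<gamma>
     + ctensor v w u \<alpha> \<beta> \<gamma> + ctensor w u v \<alpha> \<beta> \<gamma> + ctensor w v u \<alpha> \<beta> \<gamma>) / 6)"

text \<open>\<open>S\<^sup>3U\<^sup>1\<^sup>,\<^sup>0\<close>, as the complex span of the products \<open>uvw\<close> in \<open>S\<^sup>3V\<^sup>\<complex>\<close>, whose elements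
  are complex-valued trilinear forms on the real dual of \<open>V\<close>.\<close>

definition S30 :: "('v::real_vector \<Rightarrow> 'v) \<Rightarrow> 'v set \<Rightarrow> 'v ctensor3 set" where
  "S30 J U =
    {(\<lambda>\<alpha> \<beta> \<gamma>. \<Sum>i<n. c i * sym_prod (u i) (v i) (w i) \<alpha> \<beta> \<gamma>) | (n::nat) c u v w.
       \<forall>i<n. u i \<in> U10 J U \<and> v i \<in> U10 J U \<and> w i \<in> U10 J U}"

text \<open>The conjugation of \<open>S\<^sup>3V\<^sup>\<complex>\<close> is conjugation of values on real covectors, and
  \<open>S\<^sup>3V \<subseteq> S\<^sup>3V\<^sup>\<complex>\<close> consists of the forms with real values.\<close>

definition S30_rho :: "('v::real_vector \<Rightarrow> 'v) \<Rightarrow> 'v set \<Rightarrow> 'v tensor3 set" where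
  "S30_rho J U =
    {T. \<exists>Sc \<in> S30 J U. \<forall>\<alpha> \<beta> \<gamma>. complex_of_real (T \<alpha> \<beta> \<gamma>) = Sc \<alpha> \<beta> \<gamma> + cnj (Sc \<alpha> \<beta> \<gamma>)}"


definition isotropic_complex_subspace ::
  "('v::real_vector \<Rightarrow> 'v) \<Rightarrow> ('v \<Rightarrow> 'v \<Rightarrow> real) \<Rightarrow> 'v set \<Rightarrow> bool" where
  "isotropic_complex_subspace J \<omega> U \<longleftrightarrow>
    subspace U \<and> J ` U \<subseteq> U \<and> (\<forall>x\<in>U. \<forall>y\<in>U. \<omega> x y = 0)"

definition max_isotropic_complex_subspaces ::
  "('v::real_vector \<Rightarrow> 'v) \<Rightarrow> ('v \<Rightarrow> 'v \<Rightarrow> real) \<Rightarrow> 'v set set" where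
  "max_isotropic_complex_subspaces J \<omega> =
    {U. isotropic_complex_subspace J \<omega> U \<and>
        (\<forall>W. isotropic_complex_subspace J \<omega> W \<longrightarrow> dim W \<le> dim U)}"

end

(* For S in C(sp V), the quantity w(S_X Y, S_Z W) is symmetric under exchange of X with Y, of Z with W
   and of X with Z, hence unchanged when the pairs (X, Y) and (Z, W) trade places; as w is
   antisymmetric, it vanishes. So the vectors S_X Y span an isotropic subspace, J-invariant when S
   anticommutes with J, and the tensor of S lies in S^3 U for every U containing them. The tensor
   changes sign when J is applied to two of its three arguments; this removes its (2,1) and (1,2)
   parts. An isotropic complex subspace U lies in one of maximal dimension, because for a maximal W
   the subspace U + (W \<inter> U^\<bottom>) is again isotropic and complex, and dimension counting shows that
   it is at least as large as W. Conversely, for T in S^{3,0} U^rho the vectors S_Y Z are w-orthogonal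
   to U, hence S_X S_Y = 0. *)
theory Submission
  imports Defs
begin

subsection \<open>Duals and symmetric tensors\<close>

lemma dual_eqI: "(\<And>x. dual_apply \<alpha> x = dual_apply \<beta> x) \<Longrightarrow> \<alpha> = \<beta>"
  by (metis dual_apply_inject ext)

lemma linear_dual_apply: "linear (dual_apply \<alpha>)"
  using dual_apply[of \<alpha>] by simp

lemma dual_apply_Dual: "linear f \<Longrightarrow> dual_apply (Dual f) x = f x"
  by (simp add: Dual_inverse)

lemma dual_apply_sum: "dual_apply (sum h A) x = (\<Sum>a\<in>A. dual_apply (h a) x)"
  by (induction A rule: infinite_finite_induct) (simp_all add: zero_dual.rep_eq plus_dual.rep_eq)

lemma cplxn_eval_add: "cplxn_eval (\<alpha> + \<beta>) z = cplxn_eval \<alpha> z + cplxn_eval \<beta> z"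
  by (simp add: cplxn_eval_def plus_dual.rep_eq complex_eq_iff)

lemma cplxn_eval_scaleR: "cplxn_eval (r *\<^sub>R \<alpha>) z = complex_of_real r * cplxn_eval \<alpha> z"
  by (simp add: cplxn_eval_def scaleR_dual.rep_eq complex_eq_iff)

text \<open>A basis \<open>B\<close> of \<open>U\<close> is extended to a basis of the whole space,
  and \<open>e\<close> is the dual basis. The dual vectors belonging to the added basis vectors
  annihilate \<open>U\<close>, so \<open>f\<close> kills them and only the terms over
  \<open>B\<close> survive. Applied slot by slot, this writes a tensor as a combination of products
  of vectors of \<open>U\<close>.\<close>

lemma dual_expansion_vanishing:
  fixes U :: "'v::real_vector set"
  assumes "\<exists>B::'v set. finite B \<and> span B = UNIV" "subspace U"
  obtains B e where "finite B" "B \<subseteq> U"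
    "\<And>f \<alpha>. linear f \<Longrightarrow> (\<And>\<alpha>. (\<And>u. u \<in> U \<Longrightarrow> dual_apply \<alpha> u = 0) \<Longrightarrow> f \<alpha> = 0) \<Longrightarrow>
       f \<alpha> = (\<Sum>b\<in>B. dual_apply \<alpha> b *\<^sub>R f (e b) :: real)"
proof -
  obtain B where B: "B \<subseteq> U" "independent B" "U \<subseteq> span B"
    using maximal_independent_subset[of U] by blast
  obtain C where C: "B \<subseteq> C" "independent C" "span C = UNIV"
    using extend_basis_superset[OF B(2)] independent_extend_basis[OF B(2)] span_extend_basis[OF B(2)]
    by blast
  have fC: "finite C"
    using assms(1) C(2) independent_span_bound by blast
  define e where "e b = Dual (\<lambda>v. representation C v b)" for b
  have lin: "linear (\<lambda>v. representation C v b)" for b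
    using C by (intro linearI) (simp_all add: representation_add representation_scale)
  have e: "dual_apply (e b) v = representation C v b" for b v
    by (simp add: e_def dual_apply_Dual lin)
  have expand: "\<alpha> = (\<Sum>c\<in>C. dual_apply \<alpha> c *\<^sub>R e c)" for \<alpha>
  proof (rule dual_eqI)
    fix v
    have "v = (\<Sum>c\<in>C. representation C v c *\<^sub>R c)"
      using C fC by (intro sum_representation_eq[symmetric]) auto
    hence "dual_apply \<alpha> v = dual_apply \<alpha> (\<Sum>c\<in>C. representation C v c *\<^sub>R c)" by simp
    also have "\<dots> = (\<Sum>c\<in>C. representation C v c * dual_apply \<alpha> c)"
      using linear_dual_apply[of \<alpha>] by (simp add: linear_sum linear_cmul)
    finally show "dual_apply \<alpha> v = dual_apply (\<Sum>c\<in>C. dual_apply \<alpha> c *\<^sub>R e c) v"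
      by (simp add: dual_apply_sum scaleR_dual.rep_eq e mult.commute)
  qed
  show thesis
  proof (rule that)
    show "finite B" using fC C finite_subset by blast
    show "B \<subseteq> U" by fact
    fix f :: "'v dual \<Rightarrow> real" and \<alpha>
    assume f: "linear f" "\<And>\<alpha>. (\<And>u. u \<in> U \<Longrightarrow> dual_apply \<alpha> u = 0) \<Longrightarrow> f \<alpha> = 0"
    have zero: "f (e c) = 0" if "c \<in> C - B" for c
    proof (rule f(2))
      fix u assume "u \<in> U"
      hence "u \<in> span B" using B by auto
      moreover have "representation C b c = 0" if "b \<in> B" for b
        using that \<open>c \<in> C - B\<close> C by (auto simp: representation_basis)
      ultimately show "dual_apply (e c) u = 0"
        unfolding e using linear_eq_0_on_span[OF lin] by blast
    qed
    have "f \<alpha> = f (\<Sum>c\<in>C. dual_apply \<alpha> c *\<^sub>R e c)" using expand[of \<alpha>] by simp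
    also have "\<dots> = (\<Sum>c\<in>C. dual_apply \<alpha> c *\<^sub>R f (e c))"
      using f(1) by (simp add: linear_sum linear_cmul)
    also have "\<dots> = (\<Sum>c\<in>B. dual_apply \<alpha> c *\<^sub>R f (e c))"
      using fC C zero by (intro sum.mono_neutral_right) auto
    finally show "f \<alpha> = (\<Sum>c\<in>B. dual_apply \<alpha> c *\<^sub>R f (e c))" .
  qed
qed

section \<open>Elements of \<open>S30\<close> and \<open>S30_rho\<close> as trilinear forms\<close>

lemma S30_sumI:
  assumes "finite I" "\<And>i. i \<in> I \<Longrightarrow> u i \<in> U10 J U \<and> v i \<in> U10 J U \<and> w i \<in> U10 J U"
  shows "(\<lambda>\<alpha> \<beta> \<gamma>. \<Sum>i\<in>I. c i * sym_prod (u i) (v i) (w i) \<alpha> \<beta> \<gamma>) \<in> S30 J U"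
proof -
  obtain h where h: "bij_betw h {..<card I} I"
    using ex_bij_betw_nat_finite[OF assms(1)] by (auto simp: atLeast0LessThan)
  have eq: "(\<lambda>\<alpha> \<beta> \<gamma>. \<Sum>i\<in>I. c i * sym_prod (u i) (v i) (w i) \<alpha> \<beta> \<gamma>) =
      (\<lambda>\<alpha> \<beta> \<gamma>. \<Sum>i<card I. c (h i) * sym_prod (u (h i)) (v (h i)) (w (h i)) \<alpha> \<beta> \<gamma>)"
    by (intro ext sum.reindex_bij_betw[symmetric] h)
  have "h i \<in> I" if "i < card I" for i
    using h that by (auto simp: bij_betw_def)
  thus ?thesis
    unfolding S30_def eq mem_Collect_eq using assms(2)
    by (intro exI[of _ "card I"] exI[of _ "\<lambda>i. c (h i)"] exI[of _ "\<lambda>i. u (h i)"]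
        exI[of _ "\<lambda>i. v (h i)"] exI[of _ "\<lambda>i. w (h i)"]) simp
qed

text \<open>Permuting the three vectors amounts to permuting the three covectors; this makes the
  symmetry in the arguments visible.\<close>

lemma sym_prod_permute: "sym_prod u v w \<alpha> \<beta> \<gamma> =
    (ctensor u v w \<alpha> \<beta> \<gamma> + ctensor u v w \<alpha> \<gamma> \<beta> + ctensor u v w \<beta> \<alpha> \<gamma>
     + ctensor u v w \<gamma> \<alpha> \<beta> + ctensor u v w \<beta> \<gamma> \<alpha> + ctensor u v w \<gamma> \<beta> \<alpha>) / 6"
  by (simp add: sym_prod_def ctensor_def mult_ac add_ac)

lemma sym_prod_comm:
  "sym_prod u v w \<alpha> \<beta> \<gamma> = sym_prod u v w \<beta> \<alpha> \<gamma>" "sym_prod u v w \<alpha> \<beta> \<gamma> = sym_prod u v w \<alpha> \<gamma> \<beta>"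
  by (simp_all add: sym_prod_permute add_ac)

lemma sym_prod_add:
  "sym_prod u v w (\<alpha> + \<alpha>') \<beta> \<gamma> = sym_prod u v w \<alpha> \<beta> \<gamma> + sym_prod u v w \<alpha>' \<beta> \<gamma>"
  by (simp add: sym_prod_def ctensor_def cplxn_eval_add algebra_simps add_divide_distrib)

lemma sym_prod_scaleR:
  "sym_prod u v w (r *\<^sub>R \<alpha>) \<beta> \<gamma> = complex_of_real r * sym_prod u v w \<alpha> \<beta> \<gamma>"
  by (simp add: sym_prod_def ctensor_def cplxn_eval_scaleR algebra_simps add_divide_distrib)

text \<open>A tensor plus its conjugate is twice its real part. This formula is the source of every
  property of \<open>S30_rho\<close> below.\<close>

lemma S30_rhoE:
  assumes "T \<in> S30_rho J U"
  obtains n :: nat and c u v w where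
    "\<And>i. i < n \<Longrightarrow> u i \<in> U10 J U \<and> v i \<in> U10 J U \<and> w i \<in> U10 J U"
    "T = (\<lambda>\<alpha> \<beta> \<gamma>. 2 * Re (\<Sum>i<n. c i * sym_prod (u i) (v i) (w i) \<alpha> \<beta> \<gamma>))"
proof -
  from assms obtain n :: nat and c u v w where
    1: "\<forall>i<n. u i \<in> U10 J U \<and> v i \<in> U10 J U \<and> w i \<in> U10 J U" and
    2: "\<And>\<alpha> \<beta> \<gamma>. complex_of_real (T \<alpha> \<beta> \<gamma>) =
      (\<Sum>i<n. c i * sym_prod (u i) (v i) (w i) \<alpha> \<beta> \<gamma>)
      + cnj (\<Sum>i<n. c i * sym_prod (u i) (v i) (w i) \<alpha> \<beta> \<gamma>)"
    unfolding S30_rho_def S30_def by auto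
  have "T \<alpha> \<beta> \<gamma> = 2 * Re (\<Sum>i<n. c i * sym_prod (u i) (v i) (w i) \<alpha> \<beta> \<gamma>)" for \<alpha> \<beta> \<gamma>
    using arg_cong[OF 2[of \<alpha> \<beta> \<gamma>], of Re] by simp
  thus thesis using 1 that by blast
qed

lemma S30_rho_subset_S3: "S30_rho J U \<subseteq> S3"
proof
  fix T assume "T \<in> S30_rho J U"
  then obtain n :: nat and c u v w where
    T: "T = (\<lambda>\<alpha> \<beta> \<gamma>. 2 * Re (\<Sum>i<n. c i * sym_prod (u i) (v i) (w i) \<alpha> \<beta> \<gamma>))"
    by (rule S30_rhoE) blast
  have lin: "linear (\<lambda>a. T a b c)" for b c
    by (rule linearI)
      (simp_all add: T sym_prod_add sym_prod_scaleR algebra_simps sum.distrib sum_subtractf sum_distrib_left)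
  have comm: "T a b c = T b a c" "T a b c = T a c b" for a b c
    by (simp add: T sym_prod_comm(1)[of _ _ _ a b c]) (simp add: T sym_prod_comm(2)[of _ _ _ a b c])
  have lin2: "linear (\<lambda>b. T a b c)" for a c
    using lin[of a c] by (simp only: comm(1)[of _ a c])
  have "linear (T a b)" for a b
    using lin2[of a b] by (simp only: comm(2)[of a _ b])
  thus "T \<in> S3" using lin lin2 comm by (auto simp: sym_forms3_def)
qed

text \<open>The complex linear extension of a covector that is zero on \<open>U\<close> is zero on
  \<open>U10 J U\<close>, so every summand has a vanishing factor.\<close>

lemma S30_rho_vanish:
  assumes T: "T \<in> S30_rho J U" and \<alpha>: "\<And>u. u \<in> U \<Longrightarrow> dual_apply \<alpha> u = 0"
  shows "T \<alpha> \<beta> \<gamma> = 0"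
proof -
  obtain n :: nat and c u v w where
    uvw: "\<And>i. i < n \<Longrightarrow> u i \<in> U10 J U \<and> v i \<in> U10 J U \<and> w i \<in> U10 J U" and
    T: "T = (\<lambda>\<alpha> \<beta> \<gamma>. 2 * Re (\<Sum>i<n. c i * sym_prod (u i) (v i) (w i) \<alpha> \<beta> \<gamma>))"
    by (rule S30_rhoE[OF T]) blast
  have "cplxn_eval \<alpha> z = 0" if "z \<in> U10 J U" for z
    using that \<alpha> by (auto simp: cplxn_eval_def U10_def complex_eq_iff)
  hence "sym_prod (u i) (v i) (w i) \<alpha> \<beta> \<gamma> = 0" if "i < n" for i
    using uvw[OF that] by (simp add: sym_prod_def ctensor_def)
  thus ?thesis by (simp add: T)
qed

context pseudo_hermitian
begin

subsection \<open>The symplectic form and isotropic subspaces\<close>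

abbreviation om :: "'v \<Rightarrow> 'v \<Rightarrow> real" where "om \<equiv> omega J g"

text \<open>Fixing one finite basis makes the finite-dimensional theory of \<open>dim\<close>
  available on \<open>'v\<close>.\<close>

definition basis :: "'v set" where
  "basis = (SOME B. finite B \<and> independent B \<and> span B = UNIV)"

lemma basis: "finite basis" "independent basis" "span basis = UNIV"
proof -
  obtain S :: "'v set" where S: "finite S" "span S = UNIV" using finite_dim by blast
  obtain B where B: "B \<subseteq> S" "independent B" "S \<subseteq> span B"
    using maximal_independent_subset[of S] by blast
  have "finite B \<and> independent B \<and> span B = UNIV"
    using S B by (metis finite_subset span_minimal subspace_span top.extremum_uniqueI)
  hence "finite basis \<and> independent basis \<and> span basis = UNIV"
    unfolding basis_def by (rule someI)
  thus "finite basis" "independent basis" "span basis = UNIV" by auto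
qed

interpretation fd: finite_dimensional_vector_space "scaleR :: real \<Rightarrow> 'v \<Rightarrow> 'v" basis
  rewrites "module.dependent (*\<^sub>R) = dependent"
    and "module.representation (*\<^sub>R) = representation"
    and "module.subspace (*\<^sub>R) = subspace"
    and "module.span (*\<^sub>R) = span"
    and "vector_space.extend_basis (*\<^sub>R) = extend_basis"
    and "vector_space.dim (*\<^sub>R) = dim"
    and "Vector_Spaces.linear (*\<^sub>R) (*\<^sub>R) = linear"
  using basis
  by unfold_locales
    (auto simp add: dependent_raw_def representation_raw_def
      subspace_raw_def span_raw_def extend_basis_raw_def dim_raw_def linear_def)

lemma J_simps: "J (x + y) = J x + J y" "J (c *\<^sub>R x) = c *\<^sub>R J x" "J (- x) = - J x" "J 0 = 0"
  "J (x - y) = J x - J y"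
  using J_linear
  by (simp_all add: linear_add linear_cmul linear_neg linear_0 linear_diff)

lemma om_linear_left: "linear (\<lambda>x. om x y)"
  using g_bilinear J_linear unfolding bilinear_def omega_def
  by (auto intro: linear_compose[of J "\<lambda>z. g z y", unfolded comp_def])

lemma om_linear_right: "linear (om x)"
  using g_bilinear unfolding bilinear_def omega_def by auto

lemma om_simps:
  "om (x + y) z = om x z + om y z" "om z (x + y) = om z x + om z y"
  "om (c *\<^sub>R x) z = c * om x z" "om z (c *\<^sub>R x) = c * om z x"
  "om (- x) z = - om x z" "om z (- x) = - om z x"
  "om 0 z = 0" "om z 0 = 0"
  using om_linear_left om_linear_right
  by (simp_all add: linear_add[of "\<lambda>x. om x z"] linear_add linear_cmul[of "\<lambda>x. om x z"] linear_cmul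
      linear_neg[of "\<lambda>x. om x z"] linear_neg linear_0[of "\<lambda>x. om x z"] linear_0)

lemma om_J_left: "om (J x) y = - om x (J y)"
  using g_invariant[of "J x" "J y"] om_simps(6)[of "J x" y] unfolding omega_def by (simp add: J_square)

lemma om_antisym: "om x y = - om y x"
proof -
  have "om x y = g (J (J x)) (J y)" by (simp add: omega_def g_invariant)
  also have "\<dots> = g (J y) (- x)" by (simp add: J_square g_sym)
  also have "\<dots> = - om y x" using om_simps(6)[of y x] by (simp add: omega_def)
  finally show ?thesis .
qed

lemma om_nondegenerate: "(\<And>y. om x y = 0) \<Longrightarrow> x = 0"
  using g_nondegenerate[of "J x"] J_square[of x] by (fastforce simp: omega_def J_simps)

lemma om_eqI: "(\<And>z. om x z = om y z) \<Longrightarrow> x = y"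
  using om_nondegenerate[of "x - y"] om_simps(1)[of x "- y"] om_simps(5)[of y] by force

text \<open>The map \<open>h\<close> records the pairings of a vector with a basis. Nondegeneracy
  makes it injective, finite dimension then makes it surjective, and a preimage of the vector with
  coordinates \<open>f b\<close> represents \<open>f\<close>.\<close>

lemma om_riesz:
  assumes "linear f"
  obtains x where "\<And>y. f y = om y x"
proof -
  define h where "h x = (\<Sum>b\<in>basis. om b x *\<^sub>R b)" for x
  have lin: "linear h"
    by (rule linearI) (simp_all add: h_def om_simps sum.distrib scaleR_left_distrib scaleR_sum_right)
  have eq: "om b x = c b" if "h x = (\<Sum>b\<in>basis. c b *\<^sub>R b)" "b \<in> basis" for x b c
  proof -
    have "(\<Sum>b\<in>basis. (om b x - c b) *\<^sub>R b) = 0"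
      using that(1) by (simp add: h_def scaleR_left_diff_distrib sum_subtractf)
    from real_vector.independentD[OF basis(2,1) order_refl this that(2)] show ?thesis by simp
  qed
  have "x = 0" if "h x = 0" for x
  proof (rule om_nondegenerate)
    fix y
    have "om b x = 0" if "b \<in> basis" for b
      using eq[of x "\<lambda>_. 0"] that \<open>h x = 0\<close> by simp
    hence "om y x = 0"
      using linear_eq_0_on_span[OF om_linear_left, of basis x y] basis(3) by auto
    thus "om x y = 0" by (metis om_antisym neg_0_equal_iff_equal)
  qed
  hence "inj h" using linear_injective_0[OF lin] by blast
  hence "surj h" by (rule fd.linear_inj_imp_surj[OF lin])
  then obtain x where "h x = (\<Sum>b\<in>basis. f b *\<^sub>R b)" by (metis surjD)
  from eq[OF this] have "f b = om b x" if "b \<in> basis" for b using that by simp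
  hence "f y = om y x" for y
    using linear_eq_on_span[OF assms om_linear_left, of basis x y] basis(3) by auto
  thus thesis by (rule that)
qed

section \<open>Isotropic complex subspaces of largest dimension\<close>

text \<open>Each functional lowers the dimension by at most one: if \<open>f w\<close> is nonzero,
  subtracting a multiple of \<open>w\<close> moves any vector into the kernel of
  \<open>f\<close>.\<close>

lemma dim_inter_kernels:
  assumes "finite F" "\<And>f. f \<in> F \<Longrightarrow> linear (f :: 'v \<Rightarrow> real)" "subspace W"
  shows "dim W \<le> dim {w \<in> W. \<forall>f\<in>F. f w = 0} + card F"
  using assms
proof (induction F rule: finite_induct)
  case empty thus ?case by simp
next
  case (insert f F)
  let ?K = "{w \<in> W. \<forall>f\<in>F. f w = 0}" and ?L = "{w \<in> W. \<forall>f\<in>insert f F. f w = 0}"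
  have IH: "dim W \<le> dim ?K + card F" using insert by auto
  have lin: "linear f" using insert by auto
  have "dim ?K \<le> dim ?L + 1"
  proof (cases "\<exists>w\<in>?K. f w \<noteq> 0")
    case True
    then obtain w where w: "w \<in> ?K" "f w \<noteq> 0" by blast
    have "?K \<subseteq> span (insert w ?L)"
    proof
      fix v assume v: "v \<in> ?K"
      define c where "c = f v / f w"
      have "v - c *\<^sub>R w \<in> W"
        using v w insert.prems(2) by (auto intro: subspace_diff subspace_scale)
      moreover have "\<forall>h\<in>F. h (v - c *\<^sub>R w) = 0"
        using v w insert.prems(1) by (auto simp: linear_diff linear_cmul)
      moreover have "f (v - c *\<^sub>R w) = 0"
        using lin w by (simp add: linear_diff linear_cmul c_def)
      ultimately have "v - c *\<^sub>R w \<in> span ?L" by (intro span_base) auto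
      thus "v \<in> span (insert w ?L)" by (auto simp: span_insert)
    qed
    hence "dim ?K \<le> dim (insert w ?L)" by (rule fd.dim_mono)
    thus ?thesis by (simp add: fd.dim_insert split: if_splits)
  next
    case False
    hence "?K = ?L" by auto
    thus ?thesis by simp
  qed
  thus ?case using IH insert.hyps by simp
qed

text \<open>Maximality under inclusion would not do, since the dimension has to be the largest
  possible; hence \<open>U\<close> is enlarged by a part \<open>K\<close> of a \<open>W\<close> that
  attains it. The count is dim K \<ge> dim W - (dim U - dim (U \<inter> W)) together with U \<inter>
  K \<subseteq> U \<inter> W.\<close>

lemma isotropic_subset_maximal:
  assumes U: "isotropic_complex_subspace J om U"
  obtains M where "U \<subseteq> M" "M \<in> max_isotropic_complex_subspaces J om"
proof -
  have "\<exists>W. isotropic_complex_subspace J om W \<and>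
      (\<forall>W'. isotropic_complex_subspace J om W' \<longrightarrow> dim W' \<le> dim W)"
    \<comment> \<open>Dimensions of subspaces are bounded by that of the whole space, with its
      successor as a strict bound, so a largest one occurs.\<close>
    using ex_has_greatest_nat[of "isotropic_complex_subspace J om" U dim "Suc fd.dimension"]
      U fd.dim_subset_UNIV by (auto simp: less_Suc_eq_le)
  then obtain W where W: "isotropic_complex_subspace J om W"
    and max: "\<And>W'. isotropic_complex_subspace J om W' \<Longrightarrow> dim W' \<le> dim W" by blast
  note U' = U[unfolded isotropic_complex_subspace_def]
  note W' = W[unfolded isotropic_complex_subspace_def]
  define K where "K = {w \<in> W. \<forall>u\<in>U. om w u = 0}"
  define M where "M = {x + y |x y. x \<in> U \<and> y \<in> K}"
  have K: "subspace K"
    using W' unfolding K_def subspace_def by (auto simp: om_simps)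
  have JK: "J x \<in> K" if "x \<in> K" for x
    using that U' W' by (auto simp: K_def om_J_left)
  have sM: "subspace M" unfolding M_def using U' K by (intro subspace_sums) auto
  have "isotropic_complex_subspace J om M"
    unfolding isotropic_complex_subspace_def
  proof (intro conjI ballI)
    show "J ` M \<subseteq> M" using U' JK by (fastforce simp: M_def J_simps)
    fix x y assume "x \<in> M" "y \<in> M"
    then obtain a b c d where *: "x = a + b" "y = c + d" "a \<in> U" "b \<in> K" "c \<in> U" "d \<in> K"
      by (auto simp: M_def)
    have "om a c = 0" "om b c = 0" "om d a = 0" "om b d = 0"
      using * U' W' by (auto simp: K_def)
    thus "om x y = 0" using om_antisym[of a d] by (simp add: * om_simps)
  qed (fact sM)
  moreover have "dim W \<le> dim M"
  proof -
    have s: "subspace (U \<inter> W)" using U' W' by (simp add: subspace_inter)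
    obtain B where B: "B \<subseteq> U \<inter> W" "independent B" "U \<inter> W \<subseteq> span B" "card B = dim (U \<inter> W)"
      using basis_exists[of "U \<inter> W"] by blast
    obtain C where C: "B \<subseteq> C" "C \<subseteq> U" "independent C" "U \<subseteq> span C"
      using maximal_independent_subset_extend[of B U] B by blast
    have fin: "finite C" "finite B" using C B fd.finiteI_independent by blast+
    have cC: "card C = dim U" using C by (simp add: basis_card_eq_dim)
    \<comment> \<open>Vectors of \<open>B\<close> impose no condition: they lie in \<open>W\<close>,
      which is isotropic.\<close>
    let ?F = "(\<lambda>c w. om w c) ` (C - B)"
    have "{w \<in> W. \<forall>f\<in>?F. f w = 0} \<subseteq> K"
    proof
      fix w assume w: "w \<in> {w \<in> W. \<forall>f\<in>?F. f w = 0}"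
      have "om w c = 0" if "c \<in> C" for c
        using w that B W' by (cases "c \<in> B") auto
      hence "om w u = 0" if "u \<in> U" for u
        using linear_eq_0_on_span[OF om_linear_right, of C w u] C that by auto
      thus "w \<in> K" using w by (simp add: K_def)
    qed
    hence 1: "dim {w \<in> W. \<forall>f\<in>?F. f w = 0} \<le> dim K" by (rule fd.dim_subset)
    have "dim W \<le> dim {w \<in> W. \<forall>f\<in>?F. f w = 0} + card ?F"
      using fin W' om_linear_left by (intro dim_inter_kernels) auto
    also have "card ?F \<le> dim U - dim (U \<inter> W)"
      using card_image_le[of "C - B"] fin C(1) cC B(4) by (simp add: card_Diff_subset)
    finally have "dim W \<le> dim K + (dim U - dim (U \<inter> W))" using 1 by linarith
    \<comment> \<open>This makes the truncated subtraction above exact.\<close>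
    moreover have "dim (U \<inter> W) \<le> dim U" by (rule fd.dim_subset) auto
    moreover have "dim M + dim (U \<inter> K) = dim U + dim K"
      unfolding M_def using U' K by (intro fd.dim_sums_Int) auto
    moreover have "dim (U \<inter> K) \<le> dim (U \<inter> W)" by (rule fd.dim_subset) (auto simp: K_def)
    ultimately show ?thesis by linarith
  qed
  ultimately have "M \<in> max_isotropic_complex_subspaces J om"
    using max by (auto simp: max_isotropic_complex_subspaces_def intro: order_trans)
  moreover have "U \<subseteq> M"
    using subspace_0[OF K] by (force simp: M_def)
  ultimately show thesis using that by blast
qed

subsection \<open>The tensor of a prolongation\<close>

definition dualJ :: "'v dual \<Rightarrow> 'v dual" where
  "dualJ \<alpha> = Dual (\<lambda>x. dual_apply \<alpha> (J x))"

lemma dualJ: "dual_apply (dualJ \<alpha>) x = dual_apply \<alpha> (J x)"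
  unfolding dualJ_def using linear_compose[OF J_linear linear_dual_apply[of \<alpha>]]
  by (simp add: dual_apply_Dual comp_def)

text \<open>On (1,0)-vectors the complexified \<open>J\<close> is multiplication by
  \<open>\<i>\<close>, and evaluation is complex linear.\<close>

lemma cplxn_eval_dualJ: "z \<in> U10 J U \<Longrightarrow> cplxn_eval (dualJ \<alpha>) z = \<i> * cplxn_eval \<alpha> z"
  using linear_neg[OF linear_dual_apply[of \<alpha>]]
  by (auto simp: U10_def V10_def cplxn_map_def cplxn_scale_def cplxn_eval_def dualJ complex_eq_iff)

text \<open>All factors are (1,0)-vectors, so the transpose of \<open>J\<close> contributes the same
  factor \<open>\<i>\<close> in whichever slot it stands.\<close>

lemma S30_rho_dualJ:
  assumes T: "T \<in> S30_rho J U"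
  shows "T \<alpha> (dualJ \<beta>) \<gamma> = T \<alpha> \<beta> (dualJ \<gamma>)"
proof -
  obtain n :: nat and c u v w where
    uvw: "\<And>i. i < n \<Longrightarrow> u i \<in> U10 J U \<and> v i \<in> U10 J U \<and> w i \<in> U10 J U" and
    T: "T = (\<lambda>\<alpha> \<beta> \<gamma>. 2 * Re (\<Sum>i<n. c i * sym_prod (u i) (v i) (w i) \<alpha> \<beta> \<gamma>))"
    by (rule S30_rhoE[OF T]) blast
  have "sym_prod (u i) (v i) (w i) \<alpha> (dualJ \<beta>) \<gamma> = sym_prod (u i) (v i) (w i) \<alpha> \<beta> (dualJ \<gamma>)"
    if "i < n" for i
    using uvw[OF that] by (simp add: sym_prod_def ctensor_def cplxn_eval_dualJ[where U = U])
  thus ?thesis by (simp add: T)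
qed

section \<open>Identification of vectors with covectors and of tensors with forms\<close>

text \<open>The vector is the second argument, in agreement with \<open>form_of_tensor\<close>. As
  \<open>cov\<close> is bijective, tensors need only be compared on covectors of this form.\<close>

definition cov :: "'v \<Rightarrow> 'v dual" where
  "cov X = Dual (\<lambda>u. om u X)"

lemma cov_apply: "dual_apply (cov X) u = om u X"
  by (simp add: cov_def dual_apply_Dual om_linear_left)

lemma cov_simps: "cov (X + Y) = cov X + cov Y" "cov (r *\<^sub>R X) = r *\<^sub>R cov X"
  by (auto intro!: dual_eqI simp: cov_apply om_simps plus_dual.rep_eq scaleR_dual.rep_eq)

lemma linear_cov: "linear cov"
  by (rule linearI) (simp_all add: cov_simps)

lemma cov_J: "cov (J X) = - dualJ (cov X)"
  by (auto intro!: dual_eqI simp: cov_apply dualJ om_J_left uminus_dual.rep_eq)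

lemma bij_cov: "bij cov"
proof (rule bijI')
  show "cov x = cov y \<longleftrightarrow> x = y" for x y
    using om_eqI[of x y] om_antisym[of x] om_antisym[of y] cov_apply by metis
  show "\<exists>x. \<alpha> = cov x" for \<alpha>
    using om_riesz[OF linear_dual_apply[of \<alpha>]] by (metis dual_eqI cov_apply)
qed

lemma form_of_tensor_cov: "form_of_tensor om T X Y Z = T (cov X) (cov Y) (cov Z)"
  by (simp add: form_of_tensor_def cov_def)

lemma inj_form_of_tensor: "inj (form_of_tensor om)"
proof (rule injI, intro ext)
  fix T T' :: "'v tensor3" and \<alpha> \<beta> \<gamma>
  assume eq: "form_of_tensor om T = form_of_tensor om T'"
  obtain X Y Z where "\<alpha> = cov X" "\<beta> = cov Y" "\<gamma> = cov Z"
    using bij_cov by (metis bij_pointE)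
  thus "T \<alpha> \<beta> \<gamma> = T' \<alpha> \<beta> \<gamma>"
    using fun_cong[OF fun_cong[OF fun_cong[OF eq, of X], of Y], of Z]
    by (simp add: form_of_tensor_cov)
qed

text \<open>\<open>tensor_of_prolongation\<close> chooses a preimage; injectivity of
  \<open>form_of_tensor\<close> makes any symmetric preimage the chosen one.\<close>

lemma tensor_of_prolongation_eqI:
  assumes "T \<in> S3" "\<And>X Y Z. T (cov X) (cov Y) (cov Z) = om (S X Y) Z"
  shows "tensor_of_prolongation om S = T"
proof -
  have "form_of_prolongation om S = form_of_tensor om T"
    by (intro ext) (simp add: form_of_tensor_cov form_of_prolongation_def assms(2))
  thus ?thesis
    unfolding tensor_of_prolongation_def
    using inv_into_f_f[OF inj_on_subset[OF inj_form_of_tensor subset_UNIV] assms(1)] by simp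
qed

section \<open>The algebra of \<open>CJ_sp\<close>\<close>

lemma CJ_spD:
  assumes "S \<in> CJ_sp J om"
  shows "linear (S X)" "S X Y = S Y X" "om (S X Y) Z = - om Y (S X Z)"
    "S X (S Y Z) = S Y (S X Z)" "S X (J Y) = - J (S X Y)"
  using assms
  by (auto simp: CJ_sp_def C_sp_def sp_prolongation_def sp_def eq_neg_iff_add_eq_0)

text \<open>Skewness of \<open>S X\<close> and antisymmetry of the form give two signs that cancel.
  With the symmetry of \<open>S\<close>, the trilinear form is totally symmetric.\<close>

lemma CJ_sp_form_symmetric:
  assumes "S \<in> CJ_sp J om"
  shows "om (S X Y) Z = om (S X Z) Y"
  by (metis CJ_spD(3)[OF assms] om_antisym)

lemma CJ_sp_image_isotropic:
  assumes "S \<in> CJ_sp J om"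
  shows "om (S a b) (S c d) = 0"
proof -
  note S = CJ_spD[OF assms]
  \<comment> \<open>Move \<open>S a\<close> to the second argument, commute it with
    \<open>S c\<close>, and move \<open>S c\<close> back to the first.\<close>
  have swap: "om (S a b) (S c d) = om (S c b) (S a d)" for a b c d
    using S(3)[of a b "S c d"] S(3)[of c b "S a d"] S(4)[of a c d] by simp
  \<comment> \<open>One swap exchanges \<open>a\<close> with \<open>c\<close>; a second, after using
    the symmetry of \<open>S\<close>, exchanges \<open>b\<close> with \<open>d\<close>.\<close>
  have "om (S a b) (S c d) = om (S c d) (S a b)"
    by (metis swap S(2))
  thus ?thesis using om_antisym[of "S a b" "S c d"] by simp
qed

lemma image_subset_max_isotropic:
  assumes S: "S \<in> CJ_sp J om"
  obtains U where "U \<in> max_isotropic_complex_subspaces J om" "\<And>X Y. S X Y \<in> U"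
proof -
  define R where "R = {S X Y |X Y. True}"
  have "isotropic_complex_subspace J om (span R)"
    unfolding isotropic_complex_subspace_def
  proof (intro conjI ballI)
    have "J ` R \<subseteq> span R"
    proof clarify
      fix x assume "x \<in> R"
      then obtain X Y where "x = S X Y" by (auto simp: R_def)
      hence "J x = - S X (J Y)" using CJ_spD(5)[OF S, of X Y] by simp
      moreover have "S X (J Y) \<in> R" by (auto simp: R_def)
      ultimately show "J x \<in> span R" by (simp add: span_base span_neg)
    qed
    thus "J ` span R \<subseteq> span R"
      by (metis J_linear linear_span_image span_minimal subspace_span)
    have 1: "om r s = 0" if "r \<in> R" "s \<in> span R" for r s
      using linear_eq_0_on_span[OF om_linear_right, of R r s] that CJ_sp_image_isotropic[OF S]
      by (auto simp: R_def)
    show "om x y = 0" if "x \<in> span R" "y \<in> span R" for x y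
      using linear_eq_0_on_span[OF om_linear_left, of R y x] 1 that by blast
  qed simp
  then obtain U where U: "span R \<subseteq> U" "U \<in> max_isotropic_complex_subspaces J om"
    by (rule isotropic_subset_maximal)
  moreover have "S X Y \<in> U" for X Y using U span_superset[of R] by (auto simp: R_def)
  ultimately show thesis using that by blast
qed

section \<open>From tensors to prolongations\<close>

text \<open>\<open>S X Y\<close> is defined as the vector representing \<open>T\<close> with its
  first two arguments fixed, and each condition on \<open>S\<close> is tested by pairing with an
  arbitrary vector.\<close>

lemma S30_rho_in_tensor_image:
  assumes U: "isotropic_complex_subspace J om U" and T: "T \<in> S30_rho J U"
  shows "T \<in> tensor_of_prolongation om ` CJ_sp J om"
proof -
  have T3: "T \<in> S3" using S30_rho_subset_S3 T by blast
  have lin: "linear (T a b)" "linear (\<lambda>b. T a b c)" "linear (\<lambda>a. T a b c)"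
    and comm: "T a b c = T b a c" "T a b c = T a c b" for a b c
    using T3 unfolding sym_forms3_def by blast+
  have "\<exists>s. \<forall>Z. om s Z = T (cov X) (cov Y) (cov Z)" for X Y
  proof -
    have "linear (\<lambda>Z. T (cov X) (cov Y) (cov Z))"
      using linear_compose[OF linear_cov lin(1)] by (simp add: comp_def)
    from om_riesz[OF this] obtain x where "T (cov X) (cov Y) (cov Z) = om Z x" for Z by blast
    \<comment> \<open>\<open>om_riesz\<close> puts the representing vector second, whence the
      sign.\<close>
    hence "om (- x) Z = T (cov X) (cov Y) (cov Z)" for Z
      using om_antisym[of x Z] by (simp add: om_simps)
    thus ?thesis by blast
  qed
  then obtain S where S: "\<And>X Y Z. om (S X Y) Z = T (cov X) (cov Y) (cov Z)" by metis
  have sym: "S X Y = S Y X" for X Y by (rule om_eqI) (simp only: S comm)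
  have linS: "linear (S X)" for X
    by (intro linearI om_eqI)
      (simp_all add: S om_simps cov_simps linear_add[OF lin(2)] linear_cmul[OF lin(2)])
  have "S X \<in> sp om" for X
    using linS comm om_antisym[of _ "S X _"] by (auto simp: sp_def S)
  moreover have "linear (\<lambda>X. S X Y)" for Y
    using linS[of Y] by (simp only: sym[of _ Y])
  moreover have "S X (S Y Z) = 0" for X Y Z
  proof (rule om_nondegenerate)
    fix W
    \<comment> \<open>By isotropy \<open>cov u\<close> vanishes on \<open>U\<close>, so
      \<open>T\<close> vanishes on it; thus \<open>S Y Z\<close> is orthogonal to \<open>U\<close>,
      and its own covector is one on which \<open>T\<close> vanishes.\<close>
    have "dual_apply (cov (S Y Z)) u = 0" if u: "u \<in> U" for u
    proof -
      have "T (cov u) (cov Y) (cov Z) = 0"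
        using U u by (intro S30_rho_vanish[OF T])
          (simp add: cov_apply isotropic_complex_subspace_def)
      thus ?thesis
        using om_antisym[of u "S Y Z"] S[of Y Z u] comm[of _ "cov u"] by (simp add: cov_apply)
    qed
    from S30_rho_vanish[OF T this] show "om (S X (S Y Z)) W = 0"
      by (simp add: S comm(1)[of "cov X"])
  qed
  moreover have "S X (J Y) + J (S X Y) = 0" for X Y
  proof (rule om_nondegenerate)
    fix Z
    have neg: "T a (- b) c = - T a b c" "T a b (- c) = - T a b c" for a b c
      using linear_neg[OF lin(2)] linear_neg[OF lin(1)] by auto
    \<comment> \<open>The two terms are \<open>T\<close> with the transpose of \<open>J\<close> in
      the second and in the third slot, with opposite signs.\<close>
    show "om (S X (J Y) + J (S X Y)) Z = 0"
      by (simp add: om_simps om_J_left S cov_J neg S30_rho_dualJ[OF T])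
  qed
  ultimately have "S \<in> CJ_sp J om"
    using sym by (auto simp: CJ_sp_def C_sp_def sp_prolongation_def)
  moreover have "tensor_of_prolongation om S = T"
    by (rule tensor_of_prolongation_eqI) (simp_all add: T3 S)
  ultimately show ?thesis by blast
qed

section \<open>From prolongations to tensors\<close>

text \<open>The chosen preimage is meaningful only once some preimage in \<open>S3\<close> exists.
  One is obtained by transporting the form of \<open>S\<close> along the inverse of
  \<open>cov\<close>.\<close>

lemma tensor_of_prolongation_CJ_sp:
  assumes S: "S \<in> CJ_sp J om"
  shows "tensor_of_prolongation om S \<in> S3"
    and "tensor_of_prolongation om S (cov X) (cov Y) (cov Z) = om (S X Y) Z"
proof -
  note s = CJ_spD[OF S]
  define rep where "rep = inv cov"
  have rep: "rep (cov X) = X" "cov (rep \<alpha>) = \<alpha>" for X \<alpha>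
    using bij_cov by (simp_all add: rep_def bij_is_inj bij_is_surj surj_f_inv_f)
  have rep_simps: "rep (\<alpha> + \<beta>) = rep \<alpha> + rep \<beta>" "rep (r *\<^sub>R \<alpha>) = r *\<^sub>R rep \<alpha>" for \<alpha> \<beta> r
    using rep cov_simps by metis+
  define T where "T \<alpha> \<beta> \<gamma> = om (S (rep \<alpha>) (rep \<beta>)) (rep \<gamma>)" for \<alpha> \<beta> \<gamma>
  have comm: "T a b c = T b a c" "T a b c = T a c b" for a b c
    unfolding T_def using s(2) CJ_sp_form_symmetric[OF S] by metis+
  have lin: "linear (T a b)" for a b
    by (rule linearI) (simp_all add: T_def rep_simps om_simps)
  moreover have "linear (\<lambda>b. T a b c)" for a c using lin[of a c] by (simp only: comm(2)[of a _ c])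
  moreover from this have "linear (\<lambda>a. T a b c)" for b c by (simp only: comm(1)[of _ b c])
  ultimately have T3: "T \<in> S3" using comm by (auto simp: sym_forms3_def)
  moreover have "T (cov X) (cov Y) (cov Z) = om (S X Y) Z" for X Y Z
    by (simp add: T_def rep)
  ultimately have "tensor_of_prolongation om S = T"
    by (intro tensor_of_prolongation_eqI)
  thus "tensor_of_prolongation om S \<in> S3"
    "tensor_of_prolongation om S (cov X) (cov Y) (cov Z) = om (S X Y) Z"
    using T3 by (simp_all add: T_def rep)
qed

text \<open>The projection \<open>u \<mapsto> (u - \<i>Ju) / 2\<close> of \<open>V\<close> to \<open>V\<^sup>1\<^sup>,\<^sup>0\<close>.\<close>

definition proj10 :: "'v \<Rightarrow> 'v cplxn" where
  "proj10 u = ((1/2) *\<^sub>R u, - (1/2) *\<^sub>R J u)"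

lemma proj10_in_U10:
  assumes "isotropic_complex_subspace J om U" "u \<in> U"
  shows "proj10 u \<in> U10 J U"
  using assms
  by (auto simp: proj10_def U10_def V10_def cplxn_map_def cplxn_scale_def J_simps J_square
      isotropic_complex_subspace_def subspace_scale subspace_neg)

lemma cplxn_eval_proj10:
  "cplxn_eval \<alpha> (proj10 u) = (complex_of_real (dual_apply \<alpha> u) - \<i> * dual_apply (dualJ \<alpha>) u) / 2"
  using linear_cmul[OF linear_dual_apply[of \<alpha>]] linear_neg[OF linear_dual_apply[of \<alpha>]]
  by (simp add: cplxn_eval_def proj10_def dualJ complex_eq_iff)

text \<open>Expand a product of three factors (x - iy)/2: the real part keeps the terms with an even
  number of y's, each pair of which gives a minus sign, and 8 clears the halves.\<close>

lemma Re_ctensor_proj10: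
  "8 * Re (ctensor (proj10 a) (proj10 b) (proj10 c) \<alpha> \<beta> \<gamma>) =
     dual_apply \<alpha> a * dual_apply \<beta> b * dual_apply \<gamma> c
     - dual_apply (dualJ \<alpha>) a * dual_apply (dualJ \<beta>) b * dual_apply \<gamma> c
     - dual_apply (dualJ \<alpha>) a * dual_apply \<beta> b * dual_apply (dualJ \<gamma>) c
     - dual_apply \<alpha> a * dual_apply (dualJ \<beta>) b * dual_apply (dualJ \<gamma>) c"
  by (simp add: ctensor_def cplxn_eval_proj10 field_simps)

text \<open>The tensor expands in a basis of \<open>U\<close>. Replacing every basis vector by its
  (1,0)-part yields \<open>Sc\<close>, and the sign rule for \<open>J\<close> in two slots shows
  that twice its real part gives the tensor back.\<close>

lemma tensor_of_prolongation_in_S30_rho: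
  assumes S: "S \<in> CJ_sp J om" and U: "isotropic_complex_subspace J om U"
    and SU: "\<And>X Y. S X Y \<in> U"
  shows "tensor_of_prolongation om S \<in> S30_rho J U"
proof -
  note s = CJ_spD[OF S]
  define T where "T = tensor_of_prolongation om S"
  have T_cov: "T (cov X) (cov Y) (cov Z) = om (S X Y) Z" for X Y Z
    unfolding T_def by (rule tensor_of_prolongation_CJ_sp(2)[OF S])
  have lin: "linear (T a b)" "linear (\<lambda>b. T a b c)" "linear (\<lambda>a. T a b c)"
    and comm: "T a b c = T b a c" "T a b c = T a c b" for a b c
    using tensor_of_prolongation_CJ_sp(1)[OF S] unfolding sym_forms3_def T_def by blast+
  \<comment> \<open>By total symmetry the value is the first covector applied to some
    \<open>S Y Z\<close>, which lies in \<open>U\<close>.\<close>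
  have T_vanish: "T \<alpha> \<beta> \<gamma> = 0" if "\<And>u. u \<in> U \<Longrightarrow> dual_apply \<alpha> u = 0" for \<alpha> \<beta> \<gamma>
  proof -
    obtain X Y Z where XYZ: "\<alpha> = cov X" "\<beta> = cov Y" "\<gamma> = cov Z"
      using bij_cov by (metis bij_pointE)
    have "T \<alpha> \<beta> \<gamma> = om (S Y Z) X"
      unfolding XYZ T_cov using s(2) CJ_sp_form_symmetric[OF S] by metis
    thus ?thesis using that[OF SU] by (simp add: XYZ cov_apply)
  qed
  \<comment> \<open>Anticommuting \<open>J\<close> past \<open>S\<close> twice, with the symmetry of
    \<open>S\<close> in between, turns \<open>S (J X) (J Y)\<close> into
    \<open>J (J (S Y X))\<close>, that is, \<open>- S X Y\<close>.\<close>
  have T_J: "T (dualJ \<alpha>) (dualJ \<beta>) \<gamma> = - T \<alpha> \<beta> \<gamma>" for \<alpha> \<beta> \<gamma>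
  proof -
    obtain X Y Z where XYZ: "\<alpha> = cov X" "\<beta> = cov Y" "\<gamma> = cov Z"
      using bij_cov by (metis bij_pointE)
    have neg: "T (- a) b c = - T a b c" "T a (- b) c = - T a b c" for a b c
      using linear_neg[OF lin(3)] linear_neg[OF lin(2)] by auto
    have "T (dualJ \<alpha>) (dualJ \<beta>) \<gamma> = T (cov (J X)) (cov (J Y)) (cov Z)"
      by (simp add: XYZ cov_J neg)
    also have "\<dots> = om (S (J X) (J Y)) Z" by (rule T_cov)
    also have "S (J X) (J Y) = - S X Y"
      using s(5)[of "J X" Y] s(5)[of Y X] s(2)[of Y] by (simp add: J_simps J_square)
    finally show ?thesis by (simp add: om_simps XYZ T_cov)
  qed
  have T_J': "T (dualJ \<alpha>) \<beta> (dualJ \<gamma>) = - T \<alpha> \<beta> \<gamma>" "T \<alpha> (dualJ \<beta>) (dualJ \<gamma>) = - T \<alpha> \<beta> \<gamma>"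
    for \<alpha> \<beta> \<gamma>
    using T_J comm by metis+
  have "subspace U" using U by (simp add: isotropic_complex_subspace_def)
  then obtain B e where B: "finite B" "B \<subseteq> U" and
    expand: "\<And>f \<alpha>. linear f \<Longrightarrow> (\<And>\<alpha>. (\<And>u. u \<in> U \<Longrightarrow> dual_apply \<alpha> u = 0) \<Longrightarrow> f \<alpha> = 0) \<Longrightarrow>
       f \<alpha> = (\<Sum>b\<in>B. dual_apply \<alpha> b *\<^sub>R f (e b) :: real)"
    using dual_expansion_vanishing[OF finite_dim] by blast
  define t where "t a b c = T (e a) (e b) (e c)" for a b c
  have expandT: "T \<alpha> \<beta> \<gamma> = (\<Sum>(a, b, c)\<in>B \<times> B \<times> B. t a b c *
      (dual_apply \<alpha> a * dual_apply \<beta> b * dual_apply \<gamma> c))" for \<alpha> \<beta> \<gamma>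
  proof -
    have 1: "T \<alpha> \<beta> \<gamma> = (\<Sum>b\<in>B. dual_apply \<alpha> b *\<^sub>R T (e b) \<beta> \<gamma>)" for \<alpha> \<beta> \<gamma>
      by (rule expand[OF lin(3) T_vanish])
    have 2: "T \<alpha> \<beta> \<gamma> = (\<Sum>b\<in>B. dual_apply \<beta> b *\<^sub>R T \<alpha> (e b) \<gamma>)" for \<alpha> \<beta> \<gamma>
      using 1[of \<beta> \<alpha> \<gamma>] by (simp only: comm(1)[of \<alpha>])
    have 3: "T \<alpha> \<beta> \<gamma> = (\<Sum>b\<in>B. dual_apply \<gamma> b *\<^sub>R T \<alpha> \<beta> (e b))" for \<alpha> \<beta> \<gamma>
      using 2[of \<alpha> \<gamma> \<beta>] by (simp only: comm(2)[of \<alpha> \<beta>])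
    have "T \<alpha> \<beta> \<gamma> = (\<Sum>a\<in>B. dual_apply \<alpha> a *\<^sub>R (\<Sum>b\<in>B. dual_apply \<beta> b *\<^sub>R
        (\<Sum>c\<in>B. dual_apply \<gamma> c *\<^sub>R T (e a) (e b) (e c))))"
      by (simp only: 1[of \<alpha> \<beta> \<gamma>] 2[of "e x" \<beta> \<gamma> for x] 3[of "e x" "e y" \<gamma> for x y])
    thus ?thesis
      by (simp add: sum.cartesian_product[symmetric] sum_distrib_left t_def mult_ac)
  qed
  define Sc where "Sc \<alpha> \<beta> \<gamma> = (\<Sum>i\<in>B \<times> B \<times> B. complex_of_real (case i of (a, b, c) \<Rightarrow> t a b c) *
      sym_prod (proj10 (fst i)) (proj10 (fst (snd i))) (proj10 (snd (snd i))) \<alpha> \<beta> \<gamma>)"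
    for \<alpha> \<beta> \<gamma>
  have "Sc \<in> S30 J U"
    unfolding Sc_def[abs_def] using B proj10_in_U10[OF U] by (intro S30_sumI) auto
  moreover have "complex_of_real (T \<alpha> \<beta> \<gamma>) = Sc \<alpha> \<beta> \<gamma> + cnj (Sc \<alpha> \<beta> \<gamma>)" for \<alpha> \<beta> \<gamma>
  proof -
    \<comment> \<open>\<open>K\<close> is the real part of \<open>T\<close> evaluated on the three \<open>(1,0)\<close>-parts, before symmetrization.\<close>
    define K where "K \<alpha> \<beta> \<gamma> = (\<Sum>(a, b, c)\<in>B \<times> B \<times> B. t a b c *
      Re (ctensor (proj10 a) (proj10 b) (proj10 c) \<alpha> \<beta> \<gamma>))" for \<alpha> \<beta> \<gamma>
    have "8 * K \<alpha> \<beta> \<gamma> = T \<alpha> \<beta> \<gamma> - T (dualJ \<alpha>) (dualJ \<beta>) \<gamma> - T (dualJ \<alpha>) \<beta> (dualJ \<gamma>)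
        - T \<alpha> (dualJ \<beta>) (dualJ \<gamma>)" for \<alpha> \<beta> \<gamma>
      unfolding expandT K_def sum_distrib_left sum_subtractf[symmetric]
    proof (intro sum.cong refl, clarify)
      fix a b c
      show "8 * (t a b c * Re (ctensor (proj10 a) (proj10 b) (proj10 c) \<alpha> \<beta> \<gamma>)) =
         t a b c * (dual_apply \<alpha> a * dual_apply \<beta> b * dual_apply \<gamma> c) -
         t a b c * (dual_apply (dualJ \<alpha>) a * dual_apply (dualJ \<beta>) b * dual_apply \<gamma> c) -
         t a b c * (dual_apply (dualJ \<alpha>) a * dual_apply \<beta> b * dual_apply (dualJ \<gamma>) c) -
         t a b c * (dual_apply \<alpha> a * dual_apply (dualJ \<beta>) b * dual_apply (dualJ \<gamma>) c)"
        using arg_cong[OF Re_ctensor_proj10[of a b c \<alpha> \<beta> \<gamma>], of "(*) (t a b c)"]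
        by (simp only: right_diff_distrib mult.left_commute)
    qed
    \<comment> \<open>Each of the three subtracted terms equals minus \<open>T\<close>, so 8 K = 4
      T.\<close>
    hence K: "2 * K \<alpha> \<beta> \<gamma> = T \<alpha> \<beta> \<gamma>" for \<alpha> \<beta> \<gamma> using T_J T_J' by fastforce
    \<comment> \<open>The coefficients are real, so the real part of \<open>Sc\<close> is the
      average of \<open>K\<close> over the six orders of the covectors; as \<open>T\<close> is
      symmetric, all six values agree.\<close>
    have "Re (Sc \<alpha> \<beta> \<gamma>) = (K \<alpha> \<beta> \<gamma> + K \<alpha> \<gamma> \<beta> + K \<beta> \<alpha> \<gamma> + K \<gamma> \<alpha> \<beta> + K \<beta> \<gamma> \<alpha> + K \<gamma> \<beta> \<alpha>) / 6"
      unfolding Sc_def K_def Re_sum sum.distrib[symmetric] sum_divide_distrib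
      by (intro sum.cong refl) (auto simp: sym_prod_permute algebra_simps add_divide_distrib)
    moreover have "T \<alpha> \<gamma> \<beta> = T \<alpha> \<beta> \<gamma>" "T \<beta> \<alpha> \<gamma> = T \<alpha> \<beta> \<gamma>" "T \<gamma> \<alpha> \<beta> = T \<alpha> \<beta> \<gamma>"
      "T \<beta> \<gamma> \<alpha> = T \<alpha> \<beta> \<gamma>" "T \<gamma> \<beta> \<alpha> = T \<alpha> \<beta> \<gamma>"
      using comm by metis+
    ultimately have "2 * Re (Sc \<alpha> \<beta> \<gamma>) = T \<alpha> \<beta> \<gamma>"
      using K[of \<alpha> \<beta> \<gamma>] K[of \<alpha> \<gamma> \<beta>] K[of \<beta> \<alpha> \<gamma>] K[of \<gamma> \<alpha> \<beta>] K[of \<beta> \<gamma> \<alpha>] K[of \<gamma> \<beta> \<alpha>] by argo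
    thus ?thesis by (simp add: complex_eq_iff)
  qed
  ultimately show ?thesis unfolding S30_rho_def T_def by blast
qed

end

theorem theorem14:
  fixes J :: "'v::real_vector \<Rightarrow> 'v" and g :: "'v \<Rightarrow> 'v \<Rightarrow> real"
  assumes "pseudo_hermitian J g"
  shows "tensor_of_prolongation (omega J g) ` CJ_sp J (omega J g)
           = (\<Union>U \<in> max_isotropic_complex_subspaces J (omega J g). S30_rho J U)
       \<and> (\<Union>U \<in> max_isotropic_complex_subspaces J (omega J g). S30_rho J U) \<subseteq> S3"
proof -
  interpret pseudo_hermitian J g by fact
  have "T \<in> (\<Union>U \<in> max_isotropic_complex_subspaces J om. S30_rho J U)"
    if "T \<in> tensor_of_prolongation om ` CJ_sp J om" for T
  proof -
    from that obtain S where S: "S \<in> CJ_sp J om" "T = tensor_of_prolongation om S" by blast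
    obtain U where "U \<in> max_isotropic_complex_subspaces J om" "\<And>X Y. S X Y \<in> U"
      using image_subset_max_isotropic[OF S(1)] by blast
    thus ?thesis
      using tensor_of_prolongation_in_S30_rho[OF S(1), of U] S(2)
      by (auto simp: max_isotropic_complex_subspaces_def)
  qed
  moreover have "T \<in> tensor_of_prolongation om ` CJ_sp J om"
    if "U \<in> max_isotropic_complex_subspaces J om" "T \<in> S30_rho J U" for T U
    using that S30_rho_in_tensor_image by (auto simp: max_isotropic_complex_subspaces_def)
  ultimately show ?thesis using S30_rho_subset_S3 by blast
qed

end
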